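(* Let $r\in\mathbb{N}$, $\mathbf{m}=(m_1,\dots,m_r)\in\mathbb{N}^r$, $m=m_1+\cdots+m_r$, $\mathbf{f}\in\mathbb{C}^r$, $a,b,c,\alpha\in\mathbb{C}$, $n\in\mathbb{N}$, and put $\lambda=c-a-b-m$. Suppose $(1+a+b-c)_m\ne0$, $(c-a-m)_m\ne0$ and $(c-b-m)_m\ne0$. Then $$ F\left(\begin{matrix}-n,a,b,\alpha,\mathbf{f}+\mathbf{m}\\c,\;1+\lambda+\alpha,\;1-2\lambda-n,\;\mathbf{f}\end{matrix}\right) =G\cdot F\left(\begin{matrix}-n,\;a+\lambda,\;b+\lambda,\;\alpha,\;-\alpha-2\lambda-2n+1,\;\hat{\boldsymbol\zeta}+1\\c,\;1-\lambda-n,\;\alpha+2\lambda+1,\;-\alpha-2\lambda-2n,\;\hat{\boldsymbol\zeta}\end{matrix}\right), $$ where $$ G=-\frac{(\alpha+2\lambda)_{n}(\lambda)_{n}(-\alpha-2\lambda-2n)}{(2\lambda)_{n}(1+\lambda+\alpha)_{n}(\alpha+2\lambda)} $$ and $\hat{\boldsymbol\zeta}=(\zeta_1,\dots,\zeta_m)$ is the vector of zeros of the polynomial $\hat{Q}_m(a,b,c,\mathbf{f},\mathbf{m};t)$ (defined in the context).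
   Context: Notation: $(a)_n=\Gamma(a+n)/\Gamma(a)$; for vectors $(\mathbf{a})_n=\prod_j(a_j)_n$, and $\mathbf{a}+\beta$ means adding $\beta$ to each component. $F\left(\begin{smallmatrix}\mathbf{a}\\\mathbf{b}\end{smallmatrix}\right)=\sum_{k\ge0}\frac{(\mathbf{a})_k}{(\mathbf{b})_k k!}$ is the generalized hypergeometric series at unit argument. Standing convention: lower parameters are never non-positive integers, and denominators occurring in the formulas do not vanish. $$ \hat{Q}_m(a,b,c,\mathbf{f},\mathbf{m};t)=\sum_{k=0}^{m}\frac{{}_{r+1}F_{r}(-k,\mathbf{f}+\mathbf{m};\mathbf{f}\,|\,1)\,(a)_k(b)_k(t)_k}{(c-a-m)_k(c-b-m)_k\,k!}\;{}_{3}F_{2}\left(\begin{matrix}-m+k,\;t+k,\;c-a-b-m\\c-a-m+k,\;c-b-m+k\end{matrix}\,\Big|\,1\right). $$ Zeros are listed with multiplicity; as implicit in the notation $(\zeta_1,\dots,\zeta_m)$, $\hat{Q}_m$ is taken to have exact degree $m$. *)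

theory Defs
  imports
    "HOL-Analysis.Analysis"
    "HOL-Computational_Algebra.Computational_Algebra"
begin

definition pochs :: "complex list \<Rightarrow> nat \<Rightarrow> complex" where
  "pochs as k = (\<Prod>a\<leftarrow>as. pochhammer a k)"

text \<open>
  The series is at unit argument. A term with vanishing denominator is \<open>0\<close> (division by zero in HOL).
  In \<open>Qhat\<close> below, if no lower parameter in \<open>f\<close> is a nonpositive integer and
  \<open>(c-a-m)\<^sub>m\<close>, \<open>(c-b-m)\<^sub>m\<close> do not vanish, this only concerns terms after the series has
  terminated, whose numerators vanish as well.
\<close>

definition hypF :: "complex list \<Rightarrow> complex list \<Rightarrow> complex" where
  "hypF as bs = (\<Sum>k. pochs as k / (pochs bs k * fact k))"

lemma pochs_foldl: "foldl (\<lambda>r a. r * pochhammer a n) x as = x * pochs as n"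
  by (induction as arbitrary: x) (auto simp: pochs_def mult.assoc)

lemma hypF_eq_eval_fps: "hypF as bs = eval_fps (fps_hypergeo as bs 1) 1"
  by (simp add: hypF_def eval_fps_def pochs_foldl)

lemma pochs_eq_0:
  assumes "- of_nat n \<in> set as" "k > n"
  shows "pochs as k = 0"
proof -
  have "pochhammer (- of_nat n :: complex) k = 0"
    using assms(2) by (simp add: pochhammer_of_nat_eq_0_iff)
  hence "0 \<in> set (map (\<lambda>a. pochhammer a k) as)"
    using assms(1) by force
  thus ?thesis
    unfolding pochs_def by (simp add: prod_list_zero_iff)
qed

lemma hypF_terminating:
  assumes "- of_nat n \<in> set as"
  shows "hypF as bs = (\<Sum>k\<le>n. pochs as k / (pochs bs k * fact k))"
  unfolding hypF_def
  by (rule suminf_finite) (use pochs_eq_0[OF assms] in \<open>auto simp: not_le\<close>)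

definition shift_list :: "complex list \<Rightarrow> nat list \<Rightarrow> complex list" where
  "shift_list f ms = map2 (\<lambda>x k. x + of_nat k) f ms"

definition Qhat ::
  "complex \<Rightarrow> complex \<Rightarrow> complex \<Rightarrow> complex list \<Rightarrow> nat list \<Rightarrow> complex \<Rightarrow> complex" where
  "Qhat a b c f ms t = (let m = sum_list ms in
     \<Sum>k=0..m.
       hypF (- of_nat k # shift_list f ms) f *
       pochhammer a k * pochhammer b k * pochhammer t k /
       (pochhammer (c - a - of_nat m) k * pochhammer (c - b - of_nat m) k * fact k) *
       hypF [- of_nat m + of_nat k, t + of_nat k, c - a - b - of_nat m]
            [c - a - of_nat m + of_nat k, c - b - of_nat m + of_nat k])"

lemma poly_pochhammer_shift:
  "poly (pochhammer [:z, 1:] k) t = pochhammer (t + z) (k :: nat)" for t z :: complex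
  by (induction k) (simp_all add: pochhammer_Suc algebra_simps)

lemma Qhat_is_polynomial: "\<exists>p :: complex poly. \<forall>t. poly p t = Qhat a b c f ms t"
proof -
  define m where "m = sum_list ms"
  define U where "U k j = hypF (- of_nat k # shift_list f ms) f * pochhammer a k * pochhammer b k /
       (pochhammer (c - a - of_nat m) k * pochhammer (c - b - of_nat m) k * fact k) *
       (pochhammer (- of_nat m + of_nat k) j * pochhammer (c - a - b - of_nat m) j /
       (pochhammer (c - a - of_nat m + of_nat k) j * pochhammer (c - b - of_nat m + of_nat k) j *
        fact j))" for k j
  define p where "p = (\<Sum>k=0..m. \<Sum>j\<le>m-k. smult (U k j)
       (pochhammer [:0, 1:] k * pochhammer [:of_nat k, 1:] j))"
  have "poly p t = Qhat a b c f ms t" for t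
  proof -
    have H: "hypF [- of_nat m + of_nat k, t + of_nat k, c - a - b - of_nat m] bs =
        (\<Sum>j\<le>m-k. pochs [- of_nat m + of_nat k, t + of_nat k, c - a - b - of_nat m] j /
          (pochs bs j * fact j))" if "k \<le> m" for k bs
      by (rule hypF_terminating) (use that in \<open>simp add: of_nat_diff\<close>)
    have "poly (\<Sum>j\<le>m-k. smult (U k j) (pochhammer [:0, 1:] k * pochhammer [:of_nat k, 1:] j)) t =
        hypF (- of_nat k # shift_list f ms) f * pochhammer a k * pochhammer b k * pochhammer t k /
       (pochhammer (c - a - of_nat m) k * pochhammer (c - b - of_nat m) k * fact k) *
       hypF [- of_nat m + of_nat k, t + of_nat k, c - a - b - of_nat m]
            [c - a - of_nat m + of_nat k, c - b - of_nat m + of_nat k]" if "k \<le> m" for k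
      unfolding H[OF that] poly_sum sum_distrib_left
      by (rule sum.cong) (simp_all add: U_def poly_pochhammer_shift pochs_def mult_ac)
    thus ?thesis
      unfolding Qhat_def Let_def m_def[symmetric] p_def poly_sum
      by (intro sum.cong) (auto simp: poly_sum)
  qed
  thus ?thesis by blast
qed

end

(* Put P_k = (a)_k (b)_k (f+m)_k / ((c)_k (f)_k k!) and B_k = (a+lam)_k (b+lam)_k Qhat(-k) / ((c)_k k!).
   By Miller and Paris, sum P_k x^k = (1-x)^lam sum B_k x^k; at k = 0 this gives Qhat(0) = 1, so that
   (zeta+1)_k / (zeta)_k = Qhat(-k). Inserting P = (1-x)^lam * B into the left-hand side and
   exchanging the sums leaves an inner 2-balanced terminating 3F2, which has a closed form.
   The Miller-Paris identity (after a Newton expansion of (f+m)_k / (f)_k in the polynomials (-k)_j)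
   and the 2-balanced sum are both instances of one identity, an explicit formula for the
   coefficients of (1-x)^(-l) 2F1(a,b;c;x): with u = a+b+l-c it is
     (c)_n n! [x^n] (1-x)^(-l) 2F1(a,b;c;x) = (a+l)_n (b+l)_n 3F2(-n,l,u;a+l,b+l;1).
   Both sides obey the same recursion under l -> l+1, agree at l = 0, and are polynomials in l. *)
theory Submission
  imports Defs
begin

section \<open>Coefficients of \<open>(1-x)^(-l) 2F1(a,b;c;x)\<close>\<close>

text \<open>The coefficient of \<open>x^n\<close> in \<open>(1-x)^(-l) 2F1(a,b;c;x)\<close>, multiplied by \<open>n! (c)\<^sub>n\<close>.\<close>
definition euler_conv :: "'a::field_char_0 \<Rightarrow> 'a \<Rightarrow> 'a \<Rightarrow> 'a \<Rightarrow> nat \<Rightarrow> 'a" where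
  "euler_conv l a b c n =
     (\<Sum>s\<le>n. of_nat (n choose s) * pochhammer l (n - s) * pochhammer a s * pochhammer b s *
        pochhammer (c + of_nat s) (n - s))"

text \<open>This is \<open>(A)\<^sub>n (B)\<^sub>n 3F2(-n,l,u;A,B;1)\<close>, written without division.\<close>
definition euler_sum :: "'a::field_char_0 \<Rightarrow> 'a \<Rightarrow> 'a \<Rightarrow> 'a \<Rightarrow> nat \<Rightarrow> 'a" where
  "euler_sum l u A B n =
     (\<Sum>j\<le>n. (-1) ^ j * of_nat (n choose j) * pochhammer l j * pochhammer u j *
        pochhammer (A + of_nat j) (n - j) * pochhammer (B + of_nat j) (n - j))"

text \<open>Coefficient form, scaled by \<open>(p+1)!\<close>, of
  \<open>(1-x)^(-l) = (1-x) * (1-x)^(-(l+1))\<close>.\<close>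

lemma pochhammer_diff_shift:
  "pochhammer l (Suc p) = pochhammer (l + 1) (Suc p) - of_nat (Suc p) * pochhammer (l + 1) p"
  for l :: "'a::field_char_0"
  unfolding pochhammer_rec[of l p] pochhammer_Suc[of "l + 1" p] by (simp add: algebra_simps)

lemma of_nat_binomial_absorb_comp:
  "s \<le> n \<Longrightarrow> of_nat (Suc n choose s) * of_nat (Suc n - s) = (of_nat (Suc n) * of_nat (n choose s) :: 'a::field_char_0)"
  unfolding of_nat_mult[symmetric]
  using binomial_absorb_comp[of "Suc n" s] by (simp add: mult.commute)

lemma of_nat_binomial_absorb:
  "of_nat (Suc n choose Suc q) * of_nat (Suc q) = (of_nat (Suc n) * of_nat (n choose q) :: 'a::field_char_0)"
  unfolding of_nat_mult[symmetric]
  using Suc_times_binomial_eq[of n q] by (metis mult.commute)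

text \<open>Multiplication by \<open>1-x\<close> turns \<open>(1-x)^(-(l+1))\<close> into
  \<open>(1-x)^(-l)\<close>. The factor \<open>(n+1)(c+n)\<close> is the ratio of the normalizations
  \<open>n! (c)_n\<close> at \<open>n+1\<close> and at \<open>n\<close>.\<close>

lemma euler_conv_shift:
  "euler_conv l a b c (Suc n) =
     euler_conv (l + 1) a b c (Suc n) - of_nat (Suc n) * (c + of_nat n) * euler_conv (l + 1) a b c n"
proof -
  have *: "of_nat (Suc n choose s) * pochhammer l (Suc n - s) * pochhammer a s * pochhammer b s *
        pochhammer (c + of_nat s) (Suc n - s) =
      of_nat (Suc n choose s) * pochhammer (l + 1) (Suc n - s) * pochhammer a s * pochhammer b s *
        pochhammer (c + of_nat s) (Suc n - s) -
      of_nat (Suc n) * (c + of_nat n) * (of_nat (n choose s) * pochhammer (l + 1) (n - s) * pochhammer a s *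
        pochhammer b s * pochhammer (c + of_nat s) (n - s))" if "s \<le> n" for s
  proof -
    have 1: "Suc n - s = Suc (n - s)" using that by simp
    have 2: "pochhammer (c + of_nat s) (Suc n - s) = pochhammer (c + of_nat s) (n - s) * (c + of_nat n)"
      unfolding 1 pochhammer_Suc using that by (simp add: of_nat_diff)
    have 3: "pochhammer l (Suc n - s) =
        pochhammer (l + 1) (Suc n - s) - of_nat (Suc n - s) * pochhammer (l + 1) (n - s)"
      unfolding 1 by (rule pochhammer_diff_shift)
    have 4: "of_nat (n choose s) * of_nat (Suc n) = (of_nat (Suc n choose s) * of_nat (Suc n - s) :: 'a)"
      using of_nat_binomial_absorb_comp[OF that, where 'a = 'a] by (simp only: mult.commute)
    have "of_nat (Suc n choose s) * of_nat (Suc n - s) * (pochhammer (l + 1) (n - s) * pochhammer a s * pochhammer b s *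
        (pochhammer (c + of_nat s) (n - s) * (c + of_nat n)))
      = of_nat (n choose s) * of_nat (Suc n) * (pochhammer (l + 1) (n - s) * pochhammer a s * pochhammer b s *
        (pochhammer (c + of_nat s) (n - s) * (c + of_nat n)))"
      unfolding 4 ..
    thus ?thesis unfolding 2 3 by (simp only: algebra_simps)
  qed
  show ?thesis
    \<comment> \<open>The split-off terms \<open>s = n+1\<close> do not depend on \<open>l\<close>,
      so they agree on both sides.\<close>
    unfolding euler_conv_def sum_distrib_left sum.atMost_Suc
    by (simp add: * sum_subtractf)
qed

text \<open>The right-hand side was found by Gosper summation.\<close>
lemma euler_sum_shift_partial:
  fixes l u A B :: "'a::field_char_0"
  assumes "q \<le> n"
  defines "t2 \<equiv> \<lambda>j. (-1) ^ j * of_nat (n choose j) * pochhammer (l + 1) j * pochhammer (u + 1) j *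
        pochhammer (A + 1 + of_nat j) (n - j) * pochhammer (B + 1 + of_nat j) (n - j)"
  shows "(\<Sum>j\<le>q. (-1) ^ j * of_nat (Suc n choose j) * pochhammer l j * pochhammer u j *
        pochhammer (A + of_nat j) (Suc n - j) * pochhammer (B + of_nat j) (Suc n - j)
      - (-1) ^ j * of_nat (Suc n choose j) * pochhammer (l + 1) j * pochhammer (u + 1) j *
        pochhammer (A + 1 + of_nat j) (Suc n - j) * pochhammer (B + 1 + of_nat j) (Suc n - j)
      + of_nat (Suc n) * (A + B - l - u + of_nat n) * t2 j)
    = - (of_nat (Suc n) * (of_nat q + 1 + l + u) * t2 q)"
  using assms(1)
proof (induction q)
  case 0
  show ?case
    by (simp add: t2_def pochhammer_rec[of A n] pochhammer_rec[of B n] pochhammer_Suc[of "A+1" n]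
          pochhammer_Suc[of "B+1" n] algebra_simps)
next
  case (Suc p)
  then obtain d where n: "n = Suc p + d" using le_Suc_ex by blast
  define N :: 'a where "N = of_nat n"
  define P :: 'a where "P = of_nat p"
  \<comment> \<open>With \<open>n+1\<close> divided out, all three binomials are polynomial
    multiples of \<open>e\<close>; with the shared factors \<open>x\<close>, \<open>x'\<close>,
    \<open>y\<close>, \<open>z\<close> the induction step becomes a polynomial identity.\<close>
  define e :: 'a where "e = of_nat (Suc n choose Suc p) / of_nat (Suc n)"
  define x where "x = pochhammer (l + 1) p"
  define x' where "x' = pochhammer (u + 1) p"
  define y where "y = pochhammer (A + 1 + of_nat (Suc p)) d"
  define z where "z = pochhammer (B + 1 + of_nat (Suc p)) d"
  have N1: "N + 1 \<noteq> 0" unfolding N_def using of_nat_neq_0[of n, where 'a='a] by (simp add: add.commute)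
  have e0: "of_nat (Suc n choose Suc p) = (N + 1) * e"
    using N1 unfolding e_def N_def by (simp add: add.commute)
  have SN: "of_nat (Suc n) = N + 1" "of_nat n = N" "of_nat (Suc p) = P + 1" "of_nat p = P"
    unfolding N_def P_def by auto
  have NP: "of_nat (Suc n - Suc p) = N - P"
    unfolding N_def P_def n by simp
  have "(N + 1) * of_nat (n choose p) = (N + 1) * (e * (P + 1))"
    using of_nat_binomial_absorb[of n p, where 'a = 'a] unfolding e0 SN by (simp only: mult.assoc)
  hence e1: "of_nat (n choose p) = e * (P + 1)"
    using N1 by simp
  have "(N + 1) * of_nat (n choose Suc p) = (N + 1) * (e * (N - P))"
    using of_nat_binomial_absorb_comp[OF Suc.prems, where 'a = 'a] unfolding e0 SN NP by (simp only: mult.assoc)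
  hence e2: "of_nat (n choose Suc p) = e * (N - P)"
    using N1 by simp
  have D: "of_nat d = N - P - 1" unfolding N_def P_def n by simp
  have s1: "Suc n - Suc p = Suc d" "n - Suc p = d" "n - p = Suc d" unfolding n by auto
  have s2: "pochhammer (A + of_nat (Suc p)) (Suc d) = (A + P + 1) * y"
    "pochhammer (B + of_nat (Suc p)) (Suc d) = (B + P + 1) * z"
    "pochhammer (A + 1 + of_nat p) (Suc d) = (A + P + 1) * y"
    "pochhammer (B + 1 + of_nat p) (Suc d) = (B + P + 1) * z"
    unfolding pochhammer_rec y_def z_def P_def by (simp_all add: add_ac)
  have s3: "pochhammer (A + 1 + of_nat (Suc p)) (Suc d) = (A + N + 1) * y"
    "pochhammer (B + 1 + of_nat (Suc p)) (Suc d) = (B + N + 1) * z"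
    unfolding pochhammer_Suc y_def z_def D by (simp_all add: P_def algebra_simps)
  have s4: "pochhammer l (Suc p) = l * x" "pochhammer u (Suc p) = u * x'"
    unfolding pochhammer_rec x_def x'_def by auto
  have s5: "pochhammer (l + 1) (Suc p) = x * (l + 1 + P)" "pochhammer (u + 1) (Suc p) = x' * (u + 1 + P)"
    unfolding pochhammer_Suc x_def x'_def P_def by auto
  have t2p: "t2 p = (-1) ^ p * (e * (P + 1)) * x * x' * ((A + P + 1) * y) * ((B + P + 1) * z)"
    unfolding t2_def s1 s2 e1 x_def x'_def ..
  have t2S: "t2 (Suc p) = (-1) ^ Suc p * (e * (N - P)) * (x * (l + 1 + P)) * (x' * (u + 1 + P)) * y * z"
    unfolding t2_def s1 e2 s5 y_def z_def ..
  have "p \<le> n" using Suc.prems by simp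
  show ?case
    unfolding sum.atMost_Suc Suc.IH[OF \<open>p \<le> n\<close>]
    unfolding s1 s2 s3 s4 s5 e0 t2p t2S
    unfolding SN power_Suc
    by algebra
qed

text \<open>For \<open>A = a+l\<close>, \<open>B = b+l\<close>, \<open>u = a+b+l-c\<close> the
  coefficient \<open>A+B-l-u+n\<close> equals \<open>c+n\<close>, and raising \<open>l\<close> by
  one also raises \<open>u\<close>, \<open>A\<close>, \<open>B\<close> by one. So this is the
  recursion of \<open>euler_conv_shift\<close>.\<close>

lemma euler_sum_shift:
  "euler_sum l u A B (Suc n) =
     euler_sum (l + 1) (u + 1) (A + 1) (B + 1) (Suc n) -
     of_nat (Suc n) * (A + B - l - u + of_nat n) * euler_sum (l + 1) (u + 1) (A + 1) (B + 1) n"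
proof -
  \<comment> \<open>The terms \<open>j = n+1\<close> lie beyond the telescoped range; their
    difference cancels its boundary value at \<open>q = n\<close>.\<close>
  have P: "pochhammer l (Suc n) * pochhammer u (Suc n) - pochhammer (l + 1) (Suc n) * pochhammer (u + 1) (Suc n)
     = - (of_nat (Suc n) * (of_nat n + 1 + l + u) * (pochhammer (l + 1) n * pochhammer (u + 1) n))"
    unfolding pochhammer_rec[of l n] pochhammer_rec[of u n] pochhammer_Suc[of "l+1" n] pochhammer_Suc[of "u+1" n]
    by (simp add: algebra_simps)
  have "(-1) ^ Suc n * (pochhammer l (Suc n) * pochhammer u (Suc n) -
        pochhammer (l + 1) (Suc n) * pochhammer (u + 1) (Suc n)) =
     (-1) ^ n * (of_nat (Suc n) * (of_nat n + 1 + l + u) * (pochhammer (l + 1) n * pochhammer (u + 1) n))"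
    unfolding P by simp
  then show ?thesis
    using euler_sum_shift_partial[of n n l u A B]
    unfolding euler_sum_def sum.atMost_Suc sum.distrib sum_subtractf sum_distrib_left[symmetric]
    by (simp add: algebra_simps)
qed

text \<open>The common recursion gives the value at \<open>(l+1, n+1)\<close> from those at
  \<open>(l, n+1)\<close> and \<open>(l+1, n)\<close>, hence the nested induction. At
  \<open>l = 0\<close> only the terms \<open>s = n\<close> and \<open>j = 0\<close> survive.\<close>

lemma euler_conv_eq_euler_sum_nat:
  "euler_conv (of_nat k) a b c n = euler_sum (of_nat k) (a + b + of_nat k - c) (a + of_nat k) (b + of_nat k) n"
proof (induction k arbitrary: n)
  case 0
  have "euler_conv 0 a b c n = (\<Sum>s\<in>{n}. of_nat (n choose s) * pochhammer 0 (n - s) * pochhammer a s * pochhammer b s *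
        pochhammer (c + of_nat s) (n - s))"
    unfolding euler_conv_def by (rule sum.mono_neutral_right) (auto simp: pochhammer_0_left)
  moreover have "euler_sum 0 u a b n = (\<Sum>j\<in>{0}. (-1) ^ j * of_nat (n choose j) * pochhammer 0 j * pochhammer u j *
        pochhammer (a + of_nat j) (n - j) * pochhammer (b + of_nat j) (n - j))" for u
    unfolding euler_sum_def by (rule sum.mono_neutral_right) (auto simp: pochhammer_0_left)
  ultimately show ?case by simp
next
  case (Suc k)
  show ?case
  proof (induction n)
    case 0
    show ?case by (simp add: euler_conv_def euler_sum_def)
  next
    case (Suc n)
    let ?k = "of_nat k :: 'a"
    have "euler_conv (?k + 1) a b c (Suc n) = euler_conv ?k a b c (Suc n) +
        of_nat (Suc n) * (c + of_nat n) * euler_conv (?k + 1) a b c n"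
      using euler_conv_shift[of ?k a b c n] by simp
    also have "euler_conv ?k a b c (Suc n) = euler_sum ?k (a + b + ?k - c) (a + ?k) (b + ?k) (Suc n)"
      by (rule \<open>\<And>n. euler_conv ?k a b c n = _\<close>)
    also have "euler_conv (?k + 1) a b c n =
        euler_sum (?k + 1) (a + b + ?k - c + 1) (a + ?k + 1) (b + ?k + 1) n"
      using Suc.IH by (simp add: algebra_simps)
    also have "c = a + ?k + (b + ?k) - ?k - (a + b + ?k - c)" by simp
    finally show ?case
      using euler_sum_shift[of ?k "a + b + ?k - c" "a + ?k" "b + ?k" n]
      by (simp add: algebra_simps)
  qed
qed

lemma poly_pochhammer: "poly (pochhammer p k) x = pochhammer (poly p x) k"
  for p :: "'a::field_char_0 poly"
  by (induction k) (simp_all add: pochhammer_Suc)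

lemma poly_eq_if_eq_on_nat:
  fixes p q :: "'a::field_char_0 poly"
  assumes "\<And>k. poly p (of_nat k) = poly q (of_nat k)"
  shows "p = q"
proof (rule ccontr)
  assume "p \<noteq> q"
  hence "finite {x. poly (p - q) x = 0}" by (intro poly_roots_finite) simp
  moreover have "range of_nat \<subseteq> {x. poly (p - q) x = 0}" using assms by auto
  ultimately have "finite (range (of_nat :: nat \<Rightarrow> 'a))" by (rule rev_finite_subset)
  thus False by (simp add: range_inj_infinite[OF inj_of_nat])
qed

text \<open>With \<open>a\<close>, \<open>b\<close>, \<open>c\<close>, \<open>n\<close> fixed, the
  division-free forms are polynomials in \<open>l\<close> without any condition on \<open>c\<close>,
  so agreement on the naturals suffices. The case \<open>l = c-a-b\<close>, where the second
  argument of \<open>euler_sum\<close> is \<open>0\<close>, is Euler's transformation.\<close>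

theorem euler_conv_eq_euler_sum:
  "euler_conv l a b c n = euler_sum l (a + b + l - c) (a + l) (b + l) n"
proof -
  define p where "p = (\<Sum>s\<le>n. [:of_nat (n choose s) * pochhammer a s * pochhammer b s *
        pochhammer (c + of_nat s) (n - s):] * pochhammer [:0, 1:] (n - s))"
  define q where "q = (\<Sum>j\<le>n. [:(-1) ^ j * of_nat (n choose j):] * pochhammer [:0, 1:] j *
        pochhammer [:a + b - c, 1:] j * pochhammer [:a + of_nat j, 1:] (n - j) *
        pochhammer [:b + of_nat j, 1:] (n - j))"
  have p: "poly p x = euler_conv x a b c n" for x
    unfolding p_def euler_conv_def poly_sum
    by (intro sum.cong refl) (simp add: poly_pochhammer algebra_simps)
  have q: "poly q x = euler_sum x (a + b + x - c) (a + x) (b + x) n" for x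
    unfolding q_def euler_sum_def poly_sum
    by (intro sum.cong refl) (simp add: poly_pochhammer algebra_simps)
  have "p = q"
    by (rule poly_eq_if_eq_on_nat) (simp only: p q euler_conv_eq_euler_sum_nat)
  thus ?thesis using p q by metis
qed

section \<open>Passage to quotients, and the 2-balanced sum\<close>

lemma euler_sum_commute: "euler_sum l u A B n = euler_sum l u B A n"
  unfolding euler_sum_def by (intro sum.cong refl) (simp only: mult_ac)

text \<open>Since \<open>(-M)_j\<close> vanishes for \<open>j > M\<close>, only \<open>(A)_j\<close>
  and \<open>(B)_j\<close> with \<open>j\<close> up to \<open>M\<close> must be nonzero; later terms
  are zero on both sides.\<close>

lemma euler_sum_eq_hypF:
  fixes A B l :: complex
  assumes "pochhammer A M \<noteq> 0" and "pochhammer B M \<noteq> 0"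
  shows "euler_sum l (- of_nat M) A B n =
    pochhammer A n * pochhammer B n * hypF [- of_nat M, - of_nat n, l] [A, B]"
proof -
  have "(-1) ^ j * of_nat (n choose j) * pochhammer l j * pochhammer (- of_nat M) j *
      pochhammer (A + of_nat j) (n - j) * pochhammer (B + of_nat j) (n - j) =
    pochhammer A n * pochhammer B n *
      (pochhammer (- of_nat M) j * pochhammer (- of_nat n) j * pochhammer l j /
        (pochhammer A j * pochhammer B j * fact j))" if "j \<le> n" for j
  proof (cases "j \<le> M")
    case True
    have nz: "pochhammer A j \<noteq> 0" "pochhammer B j \<noteq> 0"
      using assms pochhammer_neq_0_mono True by blast+
    have sign: "(-1) ^ j * of_nat (n choose j) = pochhammer (- of_nat n :: complex) j / fact j"
      using gbinomial_pochhammer[of "of_nat n :: complex" j] by (simp add: binomial_gbinomial)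
    show ?thesis
      unfolding pochhammer_product[OF that, of A] pochhammer_product[OF that, of B] sign using nz
      by (simp add: field_simps)
  next
    case False
    hence "pochhammer (- of_nat M :: complex) j = 0" by (simp add: pochhammer_of_nat_eq_0_iff)
    thus ?thesis by simp
  qed
  thus ?thesis
    unfolding euler_sum_def hypF_terminating[of n "[- of_nat M, - of_nat n, l]", simplified]
    by (simp add: pochs_def sum_distrib_left mult.assoc)
qed

text \<open>This undoes the normalization: the left side is the plain Cauchy product of the two
  series.\<close>

lemma euler_conv_quotient:
  fixes l a b c :: "'a::field_char_0"
  assumes "pochhammer c n \<noteq> 0"
  shows "(\<Sum>s\<le>n. pochhammer l (n - s) / fact (n - s) *
      (pochhammer a s * pochhammer b s / (pochhammer c s * fact s))) =
    euler_conv l a b c n / (pochhammer c n * fact n)"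
  unfolding euler_conv_def sum_divide_distrib
proof (intro sum.cong refl)
  fix s assume "s \<in> {..n}"
  hence s: "s \<le> n" by simp
  have nz: "pochhammer c s \<noteq> 0" "pochhammer (c + of_nat s) (n - s) \<noteq> 0"
    using assms unfolding pochhammer_product[OF s, of c] by auto
  show "pochhammer l (n - s) / fact (n - s) *
      (pochhammer a s * pochhammer b s / (pochhammer c s * fact s)) =
    of_nat (n choose s) * pochhammer l (n - s) * pochhammer a s * pochhammer b s *
        pochhammer (c + of_nat s) (n - s) / (pochhammer c n * fact n)"
    unfolding pochhammer_product[OF s, of c] binomial_fact[OF s] using nz
    by (simp add: field_simps)
qed

text \<open>In \<open>euler_conv_eq_euler_sum\<close> these parameters make \<open>u = -1\<close>,
  so only \<open>j = 0\<close> and \<open>j = 1\<close> contribute. The factor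
  \<open>A + 2 * l\<close> lets the two terms combine without division.\<close>

lemma two_balanced_euler_conv:
  fixes l A :: "'a::field_char_0"
  shows "(A + 2 * l) * euler_conv (2 * l) A (- l) (1 + l + A) n =
    pochhammer l n * pochhammer (A + 2 * l) n * (A + 2 * l + 2 * of_nat n)"
\<comment> \<open>For \<open>n = 0\<close> the index \<open>j = 1\<close> lies outside the range of
  summation.\<close>
proof (cases n)
  case 0
  thus ?thesis by (simp add: euler_conv_def)
next
  case (Suc p)
  have "euler_conv (2 * l) A (- l) (1 + l + A) n = euler_sum (2 * l) (- 1) (A + 2 * l) l n"
    using euler_conv_eq_euler_sum[of "2 * l" A "- l" "1 + l + A" n] by (simp add: algebra_simps)
  also have "\<dots> = (\<Sum>j\<in>{..Suc 0}. (-1) ^ j * of_nat (n choose j) * pochhammer (2 * l) j *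
      pochhammer (- 1) j * pochhammer (A + 2 * l + of_nat j) (n - j) * pochhammer (l + of_nat j) (n - j))"
    unfolding euler_sum_def
  proof (rule sum.mono_neutral_right)
    show "\<forall>j\<in>{..n} - {..Suc 0}. (-1) ^ j * of_nat (n choose j) * pochhammer (2 * l) j *
      pochhammer (- 1) j * pochhammer (A + 2 * l + of_nat j) (n - j) * pochhammer (l + of_nat j) (n - j) = 0"
      using pochhammer_of_nat_eq_0_iff[of 1, where 'a = 'a] by auto
  qed (use Suc in auto)
  finally show ?thesis
    unfolding Suc by (simp add: pochhammer_rec algebra_simps)
qed

section \<open>Inverse convolution and reversal of Pochhammer symbols\<close>

text \<open>\<open>(l)_n / n!\<close> is the coefficient of \<open>x^n\<close> in
  \<open>(1-x)^(-l)\<close>, so the kernels for \<open>l\<close> and \<open>-l\<close> are inverse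
  power series; by Vandermonde's convolution their product has coefficients
  \<open>(0)_n / n!\<close>.\<close>

lemma pochhammer_conv_inverse:
  fixes l :: "'a::field_char_0"
  assumes "\<And>n. B n = (\<Sum>s\<le>n. pochhammer l (n - s) / fact (n - s) * P s)"
  shows "P n = (\<Sum>s\<le>n. pochhammer (- l) (n - s) / fact (n - s) * B s)"
proof -
  define F where "F l = Abs_fps (\<lambda>n. pochhammer l n / fact n)" for l :: 'a
  have "fps_nth (F (- l) * F l) n = (if n = 0 then 1 else 0)" for n
  proof -
    have "fps_nth (F (- l) * F l) n =
        (\<Sum>k\<le>n. of_nat (n choose k) * pochhammer (- l) k * pochhammer l (n - k)) / fact n"
      unfolding F_def fps_mult_nth atLeast0AtMost sum_divide_distrib
      by (intro sum.cong) (simp_all add: binomial_fact)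
    also have "\<dots> = pochhammer 0 n / fact n"
      using pochhammer_binomial_sum[of "- l" l n] by simp
    finally show ?thesis by (simp add: pochhammer_0_left)
  qed
  hence inv: "F (- l) * F l = 1" by (intro fps_ext) simp
  have conv: "fps_nth (F k * Abs_fps p) n = (\<Sum>s\<le>n. pochhammer k (n - s) / fact (n - s) * p s)" for k p n
    unfolding mult.commute[of "F k"]
    by (simp add: F_def fps_mult_nth atLeast0AtMost mult.commute)
  have "Abs_fps B = F l * Abs_fps P"
    by (intro fps_ext) (simp only: conv assms fps_nth_Abs_fps)
  hence "F (- l) * Abs_fps B = Abs_fps P"
    by (simp add: mult.assoc[symmetric] inv)
  thus ?thesis using conv[of "- l" B n] by simp
qed

text \<open>Read backwards, the last \<open>k\<close> factors of \<open>(u)_n\<close> are those of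
  \<open>(1-u-n)_k\<close> up to sign.\<close>

lemma pochhammer_reflect:
  fixes u :: "'a::field_char_0"
  assumes "k \<le> n"
  shows "pochhammer u n = (-1) ^ k * pochhammer (1 - u - of_nat n) k * pochhammer u (n - k)"
proof -
  have "pochhammer u n = pochhammer u (n - k) * pochhammer (u + of_nat (n - k)) k"
    using pochhammer_product'[of u "n - k" k] assms by simp
  moreover have "pochhammer (1 - u - of_nat n) k = (-1) ^ k * pochhammer (u + of_nat (n - k)) k"
    using pochhammer_minus[of "u + of_nat n - 1" k] assms by (simp add: of_nat_diff algebra_simps)
  ultimately show ?thesis by simp
qed

lemma pochhammer_neg_of_nat:
  assumes "k \<le> n"
  shows "pochhammer (- of_nat n :: 'a::field_char_0) k = (-1) ^ k * fact n / fact (n - k)"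
  using pochhammer_reflect[OF assms, of "1 :: 'a"]
  by (simp add: pochhammer_fact[symmetric] field_simps)

text \<open>Converts an upper parameter \<open>-n\<close> over a lower parameter
  \<open>1-u-n\<close> into the coefficient of \<open>x^(n-k)\<close> in \<open>(1-x)^(-u)\<close>.
  The left series of the theorem needs \<open>u = 2*l\<close>, the right one
  \<open>u = l\<close>.\<close>

lemma pochhammer_reflect_quotient:
  fixes u :: "'a::field_char_0"
  assumes "k \<le> n" and "pochhammer (1 - u - of_nat n) k \<noteq> 0"
  shows "pochhammer u n * (pochhammer (- of_nat n) k / pochhammer (1 - u - of_nat n) k) =
    fact n * (pochhammer u (n - k) / fact (n - k))"
  unfolding pochhammer_reflect[OF assms(1), of u] pochhammer_neg_of_nat[OF assms(1)]
  using assms(2) by (simp add: field_simps)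

lemma sum_triangle_swap:
  fixes g :: "nat \<Rightarrow> nat \<Rightarrow> 'a::comm_monoid_add"
  shows "(\<Sum>k\<le>n. \<Sum>j\<le>k. g k j) = (\<Sum>j\<le>n. \<Sum>i\<le>n - j. g (j + i) j)"
  unfolding sum.Sigma[OF finite_atMost ballI[OF finite_atMost]]
  by (rule sum.reindex_bij_witness[where i = "\<lambda>(j, i). (j + i, j)" and j = "\<lambda>(k, j). (j, k - j)"]) auto

section \<open>Binomial transform and Newton expansion\<close>

text \<open>Up to the sign \<open>(-1)^n\<close> this is the \<open>n\<close>-th forward difference
  of \<open>g\<close> at \<open>0\<close>.\<close>

definition binomial_transform :: "(nat \<Rightarrow> 'a::field_char_0) \<Rightarrow> nat \<Rightarrow> 'a" where
  "binomial_transform g n = (\<Sum>i\<le>n. (-1) ^ i * of_nat (n choose i) * g i)"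

lemma binomial_transform_diff:
  "binomial_transform (\<lambda>i. g i - h i) n = binomial_transform g n - binomial_transform h n"
  by (simp add: binomial_transform_def algebra_simps sum_subtractf)

lemma binomial_transform_Suc:
  "binomial_transform g (Suc n) = binomial_transform (\<lambda>i. g i - g (Suc i)) n"
proof -
  let ?S = "\<Sum>i\<le>n. (-1) ^ Suc i * of_nat (n choose Suc i) * g (Suc i)"
  \<comment> \<open>The added index \<open>n+1\<close> has binomial coefficient \<open>0\<close>; it
    makes room for splitting off \<open>i = 0\<close>.\<close>
  have "binomial_transform g n = (\<Sum>i\<le>Suc n. (-1) ^ i * of_nat (n choose i) * g i)"
    by (simp add: binomial_transform_def)
  also have "\<dots> = g 0 + ?S"
    unfolding sum.atMost_Suc_shift by simp
  finally have 1: "binomial_transform g n = g 0 + ?S" .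
  have "binomial_transform g (Suc n) =
      g 0 + (\<Sum>i\<le>n. (-1) ^ Suc i * of_nat (Suc n choose Suc i) * g (Suc i))"
    unfolding binomial_transform_def sum.atMost_Suc_shift by simp
  also have "(\<Sum>i\<le>n. (-1) ^ Suc i * of_nat (Suc n choose Suc i) * g (Suc i)) =
      ?S - binomial_transform (\<lambda>i. g (Suc i)) n"
    unfolding binomial_transform_def sum_subtractf[symmetric]
    by (intro sum.cong refl) (simp add: algebra_simps)
  also have "g 0 + (?S - binomial_transform (\<lambda>i. g (Suc i)) n) =
      binomial_transform (\<lambda>i. g i - g (Suc i)) n"
    unfolding binomial_transform_diff 1 by simp
  finally show ?thesis .
qed

text \<open>After one difference, the shifted transform of \<open>g\<close> is itself the transform
  of \<open>g i - g (i+1)\<close>, so the induction hypothesis is needed for that sequence as well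
  as for \<open>g\<close>.\<close>

lemma binomial_transform_involution: "binomial_transform (binomial_transform g) n = g n"
proof (induction n arbitrary: g)
  case 0
  show ?case by (simp add: binomial_transform_def)
next
  case (Suc n)
  show ?case
    unfolding binomial_transform_Suc[of "binomial_transform g"] binomial_transform_diff Suc.IH
    by (simp add: binomial_transform_Suc[of g] Suc.IH)
qed

text \<open>A shift of the argument keeps degree and leading coefficient, so the leading terms
  cancel.\<close>

lemma degree_diff_shift:
  fixes p :: "'a::field_char_0 poly"
  assumes "degree p > 0"
  shows "degree (p - pcompose p [:1, 1:]) < degree p"
proof (cases "p - pcompose p [:1, 1:] = 0")
  case False
  have 1: "degree (pcompose p [:1, 1:]) = degree p"
    by (simp add: degree_pcompose)
  have "lead_coeff (pcompose p [:1, 1:]) = lead_coeff p"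
    by (subst lead_coeff_comp) simp_all
  hence "coeff (p - pcompose p [:1, 1:]) (degree p) = 0" by (simp add: 1)
  moreover have "degree (p - pcompose p [:1, 1:]) \<le> degree p"
    by (rule degree_diff_le) (simp_all add: 1)
  ultimately show ?thesis using False eq_zero_or_degree_less by blast
qed (use assms in simp)

lemma binomial_transform_poly_eq_0:
  fixes p :: "'a::field_char_0 poly"
  assumes "degree p < n"
  shows "binomial_transform (\<lambda>i. poly p (of_nat i)) n = 0"
  using assms
proof (induction n arbitrary: p)
  case (Suc n)
  have *: "binomial_transform (\<lambda>i. poly p (of_nat i)) (Suc n) =
      binomial_transform (\<lambda>i. poly (p - pcompose p [:1, 1:]) (of_nat i)) n"
    unfolding binomial_transform_Suc by (simp add: poly_pcompose add.commute)
  show ?case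
  \<comment> \<open>A constant has no degree left to lose, but its difference is already
    zero.\<close>
  proof (cases "degree p = 0")
    case True
    then obtain x where "p = [:x:]" by (rule degree_eq_zeroE)
    thus ?thesis unfolding * by (simp add: pcompose_pCons binomial_transform_def)
  next
    case False
    thus ?thesis unfolding * using degree_diff_shift[of p] Suc.prems by (intro Suc.IH) auto
  qed
qed simp

text \<open>Both \<open>(x)_m (x+m)_k\<close> and \<open>(x)_k (x+k)_m\<close> are
  \<open>(x)_(m+k)\<close>. Hence \<open>(x+m)_k / (x)_k = (x+k)_m / (x)_m\<close>, which is
  polynomial in \<open>k\<close>.\<close>

lemma pochs_shift_quotient_poly:
  assumes "length f = length ms" and "\<forall>x\<in>set f. x \<notin> \<int>\<^sub>\<le>\<^sub>0"
  shows "\<exists>w. degree w \<le> sum_list ms \<and> (\<forall>k. poly w (of_nat k) = pochs (shift_list f ms) k / pochs f k)"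
  using assms
proof (induction f ms rule: list_induct2)
  case Nil
  show ?case by (intro exI[of _ 1]) (simp add: pochs_def shift_list_def)
next
  case (Cons x f m ms)
  then obtain w where w: "degree w \<le> sum_list ms"
    "\<And>k. poly w (of_nat k) = pochs (shift_list f ms) k / pochs f k" by auto
  define v where "v = smult (1 / pochhammer x m) (pochhammer [:x, 1:] m)"
  have nz: "pochhammer x k \<noteq> 0" for k
    using Cons.prems pochhammer_eq_0_imp_nonpos_Int by auto
  have "poly v (of_nat k) = pochhammer (x + of_nat m) k / pochhammer x k" for k
  proof -
    have "pochhammer x m * pochhammer (x + of_nat m) k = pochhammer x k * pochhammer (of_nat k + x) m"
      using pochhammer_product'[of x m k] pochhammer_product'[of x k m] by (simp add: add.commute)
    thus ?thesis using nz[of k] nz[of m]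
      by (simp add: v_def poly_pochhammer_shift field_simps)
  qed
  moreover have "degree (pochhammer [:x, 1:] m) \<le> m"
  proof (induction m)
    case (Suc m)
    have "degree ([:x, 1:] + of_nat m) \<le> 1" by (intro degree_add_le) auto
    with Suc show ?case
      unfolding pochhammer_Suc using degree_mult_le[of "pochhammer [:x, 1:] m" "[:x, 1:] + of_nat m"]
      by linarith
  qed simp
  hence "degree (v * w) \<le> sum_list (m # ms)"
    using w(1) degree_mult_le[of v w] degree_smult_le[of "1 / pochhammer x m" "pochhammer [:x, 1:] m"]
    unfolding v_def by simp
  ultimately show ?case
    by (intro exI[of _ "v * w"]) (simp add: w(2) pochs_def shift_list_def)
qed

text \<open>\<open>(-j)_k / k!\<close> is a signed binomial coefficient. Hence the first
  \<open>hypF\<close> factors in \<open>Qhat\<close> are the Newton coefficients of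
  \<open>(f+m)_k / (f)_k\<close>.\<close>

lemma hypF_eq_binomial_transform:
  "hypF (- of_nat j # as) bs = binomial_transform (\<lambda>k. pochs as k / pochs bs k) j"
  unfolding hypF_terminating[of j "- of_nat j # as", simplified] binomial_transform_def
  by (intro sum.cong refl)
     (simp add: pochs_def pochhammer_neg_of_nat binomial_fact)

text \<open>Binomial inversion gives the Newton expansion; it stops at \<open>sum_list ms\<close>
  because the quotient agrees with a polynomial of at most that degree.\<close>

lemma pochs_shift_quotient_expansion:
  assumes "length f = length ms" and "\<forall>x\<in>set f. x \<notin> \<int>\<^sub>\<le>\<^sub>0"
  shows "pochs (shift_list f ms) k / pochs f k =
    (\<Sum>j\<le>sum_list ms. hypF (- of_nat j # shift_list f ms) f * pochhammer (- of_nat k) j / fact j)"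
proof -
  define g where "g k = pochs (shift_list f ms) k / pochs f k" for k
  obtain w where w: "degree w \<le> sum_list ms" "\<And>k. poly w (of_nat k) = g k"
    unfolding g_def using pochs_shift_quotient_poly[OF assms] by blast
  have 0: "binomial_transform g j = 0" if "j > sum_list ms" for j
    using binomial_transform_poly_eq_0[of w j] w that by simp
  have "g k = (\<Sum>j\<le>k. (-1) ^ j * of_nat (k choose j) * binomial_transform g j)"
    using binomial_transform_involution[of g k] by (simp add: binomial_transform_def[of "binomial_transform g"])
  \<comment> \<open>Widening the range adds only zero binomials; the cut that follows drops only
    vanishing transforms.\<close>
  also have "\<dots> = (\<Sum>j\<le>max k (sum_list ms). (-1) ^ j * of_nat (k choose j) * binomial_transform g j)"
    by (rule sum.mono_neutral_left) auto
  also have "\<dots> = (\<Sum>j\<le>sum_list ms. (-1) ^ j * of_nat (k choose j) * binomial_transform g j)"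
    by (rule sum.mono_neutral_right) (auto simp: 0)
  also have "\<dots> = (\<Sum>j\<le>sum_list ms. binomial_transform g j * pochhammer (- of_nat k) j / fact j)"
    using gbinomial_pochhammer[of "of_nat k :: complex"]
    by (intro sum.cong refl) (simp add: binomial_gbinomial)
  finally show ?thesis
    by (simp add: hypF_eq_binomial_transform g_def[abs_def])
qed

section \<open>The Miller-Paris identity\<close>

text \<open>The contribution of one Newton polynomial \<open>(-s)_j\<close>. It kills
  \<open>s < j\<close>; shifting \<open>s\<close> by \<open>j\<close> raises \<open>a\<close>,
  \<open>b\<close>, \<open>c\<close> by \<open>j\<close> and makes \<open>u = -(m-j)\<close>, which
  yields the terminating 3F2 of \<open>Qhat\<close>.\<close>

lemma miller_paris_term:
  fixes a b c l :: complex
  assumes l: "l = c - a - b - of_nat m" and j: "j \<le> m"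
    and c: "\<And>k. pochhammer c k \<noteq> 0"
    and A: "pochhammer (c - a - of_nat m) m \<noteq> 0"
    and B: "pochhammer (c - b - of_nat m) m \<noteq> 0"
  shows "(\<Sum>s\<le>i. pochhammer l (i - s) / fact (i - s) *
      (pochhammer a s * pochhammer b s / (pochhammer c s * fact s) * pochhammer (- of_nat s) j)) =
    pochhammer (a + l) i * pochhammer (b + l) i / (pochhammer c i * fact i) *
    (pochhammer a j * pochhammer b j * pochhammer (- of_nat i) j /
      (pochhammer (c - a - of_nat m) j * pochhammer (c - b - of_nat m) j) *
     hypF [- of_nat m + of_nat j, - of_nat i + of_nat j, c - a - b - of_nat m]
          [c - a - of_nat m + of_nat j, c - b - of_nat m + of_nat j])"
proof (cases "j \<le> i")
  case False
  hence "pochhammer (- of_nat s :: complex) j = 0" if "s \<le> i" for s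
    using that by (simp add: pochhammer_of_nat_eq_0_iff)
  thus ?thesis by simp
next
  case True
  define d where "d = i - j"
  have i: "i = j + d" using True by (simp add: d_def)
  have bl: "b + l = c - a - of_nat m" and al: "a + l = c - b - of_nat m" by (simp_all add: l)
  \<comment> \<open>Splitting at \<open>j\<close> covers both the denominator in \<open>Qhat\<close>
    and the symbol of length \<open>m-j\<close> that \<open>euler_sum_eq_hypF\<close> requires to be
    nonzero.\<close>
  have nzA: "pochhammer (b + l) j \<noteq> 0" "pochhammer (b + l + of_nat j) (m - j) \<noteq> 0"
    using A unfolding bl pochhammer_product[OF j] by auto
  have nzB: "pochhammer (a + l) j \<noteq> 0" "pochhammer (a + l + of_nat j) (m - j) \<noteq> 0"
    using B unfolding al pochhammer_product[OF j] by auto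
  have cj: "pochhammer (c + of_nat j) d \<noteq> 0"
    using c[of i] unfolding i pochhammer_product' by simp
  let ?g = "\<lambda>s. pochhammer l (i - s) / fact (i - s) *
      (pochhammer a s * pochhammer b s / (pochhammer c s * fact s) * pochhammer (- of_nat s) j)"
  have "(\<Sum>s\<le>i. ?g s) = (\<Sum>s\<in>{j..i}. ?g s)"
    by (rule sum.mono_neutral_right) (auto simp: pochhammer_of_nat_eq_0_iff)
  also have "\<dots> = (\<Sum>s\<le>d. ?g (j + s))"
    by (rule sum.reindex_bij_witness[where i = "\<lambda>s. j + s" and j = "\<lambda>s. s - j"]) (auto simp: i)
  also have "\<dots> = (-1) ^ j * pochhammer a j * pochhammer b j / pochhammer c j *
      (\<Sum>s\<le>d. pochhammer l (d - s) / fact (d - s) *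
        (pochhammer (a + of_nat j) s * pochhammer (b + of_nat j) s / (pochhammer (c + of_nat j) s * fact s)))"
    unfolding sum_distrib_left
  proof (intro sum.cong refl)
    fix s
    \<comment> \<open>Up to sign, \<open>(-(j+s))_j\<close> turns \<open>1/(j+s)!\<close> into
      \<open>1/s!\<close>, so a 2F1 summand in \<open>s\<close> remains.\<close>
    have "pochhammer (- of_nat (j + s) :: complex) j / fact (j + s) = (-1) ^ j / fact s"
      using pochhammer_neg_of_nat[of j "j + s", where 'a = complex] by simp
    moreover have "?g (j + s) = pochhammer l (d - s) / fact (d - s) *
        (pochhammer a (j + s) * pochhammer b (j + s) / pochhammer c (j + s) *
          (pochhammer (- of_nat (j + s)) j / fact (j + s)))"
      by (simp add: i)
    ultimately show "?g (j + s) = (-1) ^ j * pochhammer a j * pochhammer b j / pochhammer c j *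
      (pochhammer l (d - s) / fact (d - s) *
        (pochhammer (a + of_nat j) s * pochhammer (b + of_nat j) s / (pochhammer (c + of_nat j) s * fact s)))"
      by (simp only: pochhammer_product' times_divide_times_eq times_divide_eq_right times_divide_eq_left
            divide_divide_eq_left divide_divide_eq_right ac_simps)
  qed
  also have "(\<Sum>s\<le>d. pochhammer l (d - s) / fact (d - s) *
        (pochhammer (a + of_nat j) s * pochhammer (b + of_nat j) s / (pochhammer (c + of_nat j) s * fact s))) =
      euler_conv l (a + of_nat j) (b + of_nat j) (c + of_nat j) d / (pochhammer (c + of_nat j) d * fact d)"
    by (rule euler_conv_quotient[OF cj])
  also have "euler_conv l (a + of_nat j) (b + of_nat j) (c + of_nat j) d =
      euler_sum l (- of_nat (m - j)) (b + l + of_nat j) (a + l + of_nat j) d"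
    unfolding euler_conv_eq_euler_sum euler_sum_commute[of l _ "b + l + of_nat j"]
    using j by (simp add: l of_nat_diff algebra_simps)
  also have "\<dots> = pochhammer (b + l + of_nat j) d * pochhammer (a + l + of_nat j) d *
      hypF [- of_nat (m - j), - of_nat d, l] [b + l + of_nat j, a + l + of_nat j]"
    by (rule euler_sum_eq_hypF[OF nzA(2) nzB(2)])
  also have "[- of_nat (m - j), - of_nat d, l] =
      [- of_nat m + of_nat j, - of_nat i + of_nat j, c - a - b - of_nat m]"
    using j by (simp add: i l of_nat_diff)
  finally have eq: "(\<Sum>s\<le>i. ?g s) = (-1) ^ j * pochhammer a j * pochhammer b j / pochhammer c j *
      (pochhammer (b + l + of_nat j) d * pochhammer (a + l + of_nat j) d *
        hypF [- of_nat m + of_nat j, - of_nat i + of_nat j, c - a - b - of_nat m]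
          [b + l + of_nat j, a + l + of_nat j] / (pochhammer (c + of_nat j) d * fact d))" .
  have split: "pochhammer x i = pochhammer x j * pochhammer (x + of_nat j) d" for x :: complex
    unfolding i by (rule pochhammer_product')
  show ?thesis
    unfolding eq bl[symmetric] al[symmetric] split pochhammer_neg_of_nat[OF True] d_def[symmetric]
    using nzA(1) nzB(1) c[of j] cj by simp
qed

text \<open>Coefficientwise form of \<open>(1-x)^(-l) F(a,b,f+m;c,f;x) = F(a+l,b+l,\<zeta>+1;c,\<zeta>;x)\<close>.\<close>
lemma miller_paris_coefficients:
  fixes a b c l :: complex
  assumes len: "length f = length ms" and f: "\<forall>x\<in>set f. x \<notin> \<int>\<^sub>\<le>\<^sub>0"
    and l: "l = c - a - b - of_nat (sum_list ms)"
    and c: "\<And>k. pochhammer c k \<noteq> 0"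
    and A: "pochhammer (c - a - of_nat (sum_list ms)) (sum_list ms) \<noteq> 0"
    and B: "pochhammer (c - b - of_nat (sum_list ms)) (sum_list ms) \<noteq> 0"
  shows "pochhammer (a + l) i * pochhammer (b + l) i / (pochhammer c i * fact i) *
      Qhat a b c f ms (- of_nat i) =
    (\<Sum>s\<le>i. pochhammer l (i - s) / fact (i - s) *
      (pochhammer a s * pochhammer b s / (pochhammer c s * fact s) * (pochs (shift_list f ms) s / pochs f s)))"
proof -
  define m where "m = sum_list ms"
  define h where "h j = hypF (- of_nat j # shift_list f ms) f" for j
  define T where "T s j = pochhammer l (i - s) / fact (i - s) *
      (pochhammer a s * pochhammer b s / (pochhammer c s * fact s) * pochhammer (- of_nat s) j)" for s j
  have "(\<Sum>s\<le>i. pochhammer l (i - s) / fact (i - s) *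
      (pochhammer a s * pochhammer b s / (pochhammer c s * fact s) * (pochs (shift_list f ms) s / pochs f s)))
    = (\<Sum>s\<le>i. \<Sum>j\<le>m. h j / fact j * T s j)"
    unfolding pochs_shift_quotient_expansion[OF len f] sum_distrib_left m_def h_def T_def
    by (intro sum.cong refl) (simp add: mult_ac)
  \<comment> \<open>The inner sum over \<open>s\<close> no longer involves \<open>f\<close>.\<close>
  also have "\<dots> = (\<Sum>j\<le>m. h j / fact j * (\<Sum>s\<le>i. T s j))"
    by (subst sum.swap) (simp only: sum_distrib_left)
  also have "\<dots> = (\<Sum>j\<le>m. pochhammer (a + l) i * pochhammer (b + l) i / (pochhammer c i * fact i) *
      (h j * pochhammer a j * pochhammer b j * pochhammer (- of_nat i) j /
       (pochhammer (c - a - of_nat m) j * pochhammer (c - b - of_nat m) j * fact j) *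
       hypF [- of_nat m + of_nat j, - of_nat i + of_nat j, c - a - b - of_nat m]
            [c - a - of_nat m + of_nat j, c - b - of_nat m + of_nat j]))"
    unfolding T_def
    using miller_paris_term[OF l _ c A B, of _ i, folded m_def]
    by (intro sum.cong refl) (simp add: mult_ac)
  finally show ?thesis
    unfolding Qhat_def Let_def m_def h_def atLeast0AtMost sum_distrib_left by simp
qed

section \<open>Exchange of sums with a 2-balanced inner sum\<close>

text \<open>Stated for any sequences whose generating functions satisfy
  \<open>B = (1-x)^(-l) P\<close>, since \<open>a\<close>, \<open>b\<close>, \<open>c\<close> and
  \<open>f\<close> enter only through this relation.\<close>

lemma two_balanced_transformation:
  fixes l \<alpha> :: complex
  assumes conv: "\<And>i. B i = (\<Sum>s\<le>i. pochhammer l (i - s) / fact (i - s) * P s)"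
    and d1: "\<And>k. pochhammer (1 + l + \<alpha>) k \<noteq> 0"
    and d2: "\<And>k. pochhammer (1 - 2 * l - of_nat n) k \<noteq> 0"
    and d3: "\<And>k. pochhammer (1 - l - of_nat n) k \<noteq> 0"
    and d4: "\<And>k. pochhammer (\<alpha> + 2 * l + 1) k \<noteq> 0"
    and d5: "\<And>k. pochhammer (- \<alpha> - 2 * l - 2 * of_nat n) k \<noteq> 0"
    and d6: "pochhammer (2 * l) n \<noteq> 0" and d7: "\<alpha> + 2 * l \<noteq> 0"
  shows "(\<Sum>k\<le>n. pochhammer (- of_nat n) k * pochhammer \<alpha> k /
        (pochhammer (1 + l + \<alpha>) k * pochhammer (1 - 2 * l - of_nat n) k) * P k) =
    - (pochhammer (\<alpha> + 2 * l) n * pochhammer l n * (- \<alpha> - 2 * l - 2 * of_nat n)) /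
      (pochhammer (2 * l) n * pochhammer (1 + l + \<alpha>) n * (\<alpha> + 2 * l)) *
    (\<Sum>j\<le>n. pochhammer (- of_nat n) j * pochhammer \<alpha> j * pochhammer (- \<alpha> - 2 * l - 2 * of_nat n + 1) j /
        (pochhammer (1 - l - of_nat n) j * pochhammer (\<alpha> + 2 * l + 1) j *
         pochhammer (- \<alpha> - 2 * l - 2 * of_nat n) j) * B j)"
    (is "?L = ?G * ?R")
proof -
  define X where "X = \<alpha> + 2 * l + 2 * of_nat n"
  have Pk: "P k = (\<Sum>j\<le>k. pochhammer (- l) (k - j) / fact (k - j) * B j)" for k
    by (rule pochhammer_conv_inverse[OF conv])
  \<comment> \<open>The sum over \<open>k = j+i\<close> for fixed \<open>j\<close>. Pulling out
    \<open>(\<alpha>)_j / (1+l+\<alpha>)_j\<close> leaves the 2-balanced sum with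
    \<open>A = \<alpha>+j\<close> and length \<open>n-j\<close>.\<close>
  have inner: "(\<Sum>i\<le>n - j. pochhammer (2 * l) (n - (j + i)) / fact (n - (j + i)) *
        (pochhammer \<alpha> (j + i) / pochhammer (1 + l + \<alpha>) (j + i)) *
        (pochhammer (- l) (j + i - j) / fact (j + i - j))) =
      pochhammer \<alpha> j * pochhammer l (n - j) * pochhammer (\<alpha> + 2 * l) n * (X - of_nat j) /
      (fact (n - j) * pochhammer (1 + l + \<alpha>) n * ((\<alpha> + 2 * l) * pochhammer (\<alpha> + 2 * l + 1) j))"
    if j: "j \<le> n" for j
  proof -
    define N where "N = n - j"
    define A where "A = \<alpha> + of_nat j"
    have n: "n = j + N" using j by (simp add: N_def)
    have nz: "pochhammer (1 + l + \<alpha>) j \<noteq> 0" "pochhammer (1 + l + A) N \<noteq> 0"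
      using d1[of n] unfolding n pochhammer_product' A_def by (auto simp: add_ac)
    \<comment> \<open>Factoring \<open>(\<alpha>+2l)_(j+1)\<close> in two ways trades the divisor
      \<open>A+2l\<close> of the closed form for the lower parameter
      \<open>\<alpha>+2l+1\<close>.\<close>
    have "(\<alpha> + 2 * l) * pochhammer (\<alpha> + 2 * l + 1) j = pochhammer (\<alpha> + 2 * l) j * (A + 2 * l)"
      using pochhammer_rec[of "\<alpha> + 2 * l" j] pochhammer_Suc[of "\<alpha> + 2 * l" j] by (simp add: A_def add_ac)
    moreover have "(\<alpha> + 2 * l) * pochhammer (\<alpha> + 2 * l + 1) j \<noteq> 0"
      using d4 d7 by simp
    ultimately have nz2: "pochhammer (\<alpha> + 2 * l) j \<noteq> 0" "A + 2 * l \<noteq> 0"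
      and e: "(\<alpha> + 2 * l) * pochhammer (\<alpha> + 2 * l + 1) j = pochhammer (\<alpha> + 2 * l) j * (A + 2 * l)"
      by auto
    have "(\<Sum>i\<le>N. pochhammer (2 * l) (n - (j + i)) / fact (n - (j + i)) *
        (pochhammer \<alpha> (j + i) / pochhammer (1 + l + \<alpha>) (j + i)) *
        (pochhammer (- l) (j + i - j) / fact (j + i - j))) =
      pochhammer \<alpha> j / pochhammer (1 + l + \<alpha>) j *
      (\<Sum>i\<le>N. pochhammer (2 * l) (N - i) / fact (N - i) *
        (pochhammer A i * pochhammer (- l) i / (pochhammer (1 + l + A) i * fact i)))"
      unfolding sum_distrib_left
    proof (intro sum.cong refl)
      fix i
      have shift: "1 + l + \<alpha> + of_nat j = 1 + l + A" by (simp add: A_def)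
      show "pochhammer (2 * l) (n - (j + i)) / fact (n - (j + i)) *
        (pochhammer \<alpha> (j + i) / pochhammer (1 + l + \<alpha>) (j + i)) *
        (pochhammer (- l) (j + i - j) / fact (j + i - j)) =
        pochhammer \<alpha> j / pochhammer (1 + l + \<alpha>) j *
        (pochhammer (2 * l) (N - i) / fact (N - i) *
          (pochhammer A i * pochhammer (- l) i / (pochhammer (1 + l + A) i * fact i)))"
        unfolding pochhammer_product' shift A_def[symmetric] by (simp add: n mult_ac)
    qed
    also have "\<dots> = pochhammer \<alpha> j / pochhammer (1 + l + \<alpha>) j *
        (euler_conv (2 * l) A (- l) (1 + l + A) N / (pochhammer (1 + l + A) N * fact N))"
      by (simp only: euler_conv_quotient[OF nz(2)])
    also have "euler_conv (2 * l) A (- l) (1 + l + A) N =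
        pochhammer l N * pochhammer (A + 2 * l) N * (A + 2 * l + 2 * of_nat N) / (A + 2 * l)"
      using two_balanced_euler_conv[of A l N] nz2(2) by (simp add: field_simps)
    also have "A + 2 * l + 2 * of_nat N = X - of_nat j"
      by (simp add: A_def X_def n)
    finally show ?thesis
      unfolding N_def[symmetric] e
      unfolding n pochhammer_product'[of "\<alpha> + 2 * l" j N] pochhammer_product'[of "1 + l + \<alpha>" j N]
      using nz nz2 by (simp add: A_def ac_simps)
  qed
  \<comment> \<open>The factor \<open>(2l)_n\<close> allows the parameters \<open>-n\<close> and
    \<open>1-2l-n\<close> to become \<open>(2l)_(n-k) / (n-k)!\<close>; it is cancelled at the
    end.\<close>
  have "pochhammer (2 * l) n * ?L = (\<Sum>k\<le>n. fact n * (pochhammer (2 * l) (n - k) / fact (n - k) *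
        (pochhammer \<alpha> k / pochhammer (1 + l + \<alpha>) k) * P k))"
    unfolding sum_distrib_left
  proof (intro sum.cong refl)
    fix k assume "k \<in> {..n}"
    hence "pochhammer (2 * l) n * (pochhammer (- of_nat n) k / pochhammer (1 - 2 * l - of_nat n) k) =
        fact n * (pochhammer (2 * l) (n - k) / fact (n - k))"
      using pochhammer_reflect_quotient[of k n "2 * l"] d2 by simp
    from arg_cong[OF this, of "\<lambda>x. x * (pochhammer \<alpha> k / pochhammer (1 + l + \<alpha>) k * P k)"]
    show "pochhammer (2 * l) n * (pochhammer (- of_nat n) k * pochhammer \<alpha> k /
        (pochhammer (1 + l + \<alpha>) k * pochhammer (1 - 2 * l - of_nat n) k) * P k) =
      fact n * (pochhammer (2 * l) (n - k) / fact (n - k) *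
        (pochhammer \<alpha> k / pochhammer (1 + l + \<alpha>) k) * P k)"
      by (simp add: mult_ac)
  qed
  also have "\<dots> = fact n * (\<Sum>k\<le>n. \<Sum>j\<le>k. pochhammer (2 * l) (n - k) / fact (n - k) *
        (pochhammer \<alpha> k / pochhammer (1 + l + \<alpha>) k) *
        (pochhammer (- l) (k - j) / fact (k - j)) * B j)"
    unfolding Pk by (simp add: sum_distrib_left mult.assoc)
  also have "\<dots> = fact n * (\<Sum>j\<le>n. (\<Sum>i\<le>n - j. pochhammer (2 * l) (n - (j + i)) / fact (n - (j + i)) *
        (pochhammer \<alpha> (j + i) / pochhammer (1 + l + \<alpha>) (j + i)) *
        (pochhammer (- l) (j + i - j) / fact (j + i - j))) * B j)"
    unfolding sum_triangle_swap sum_distrib_right ..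
  also have "\<dots> = (\<Sum>j\<le>n. fact n * (pochhammer \<alpha> j * pochhammer l (n - j) * pochhammer (\<alpha> + 2 * l) n * (X - of_nat j) /
      (fact (n - j) * pochhammer (1 + l + \<alpha>) n * ((\<alpha> + 2 * l) * pochhammer (\<alpha> + 2 * l + 1) j)) * B j))"
    unfolding sum_distrib_left by (intro sum.cong refl) (simp only: inner atMost_iff)
  also have "\<dots> = pochhammer (2 * l) n * (?G * ?R)"
    unfolding sum_distrib_left
  proof (intro sum.cong refl)
    fix j assume "j \<in> {..n}"
    hence j: "j \<le> n" by simp
    have mX: "- \<alpha> - 2 * l - 2 * of_nat n = - X" by (simp add: X_def)
    have X0: "X \<noteq> 0" using d5[of 1] unfolding mX by simp
    \<comment> \<open>Since \<open>(1-X)_j / (-X)_j = (X-j)/X\<close>, the linear factor of the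
      inner sum becomes the parameter pair \<open>-\<alpha>-2l-2n+1\<close> over
      \<open>-\<alpha>-2l-2n\<close>, and \<open>X\<close> goes into the prefactor.\<close>
    have "- X * pochhammer (- X + 1) j = pochhammer (- X) j * (- X + of_nat j)"
      using pochhammer_rec[of "- X" j] pochhammer_Suc[of "- X" j] by simp
    hence lin: "pochhammer (- X + 1) j = pochhammer (- X) j * ((X - of_nat j) / X)"
      using X0 by (simp add: field_simps)
    have Xj: "pochhammer (- X) j \<noteq> 0" using d5[of j] unfolding mX .
    have lj: "fact n * (pochhammer l (n - j) / fact (n - j)) =
        pochhammer l n * (pochhammer (- of_nat n) j / pochhammer (1 - l - of_nat n) j)"
      using pochhammer_reflect_quotient[OF j d3] by simp
    have "fact n * (pochhammer \<alpha> j * pochhammer l (n - j) * pochhammer (\<alpha> + 2 * l) n * (X - of_nat j) /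
        (fact (n - j) * pochhammer (1 + l + \<alpha>) n * ((\<alpha> + 2 * l) * pochhammer (\<alpha> + 2 * l + 1) j)) * B j) =
      fact n * (pochhammer l (n - j) / fact (n - j)) *
        (pochhammer \<alpha> j * pochhammer (\<alpha> + 2 * l) n * (X - of_nat j) /
        (pochhammer (1 + l + \<alpha>) n * ((\<alpha> + 2 * l) * pochhammer (\<alpha> + 2 * l + 1) j)) * B j)"
      by (simp add: mult_ac)
    also have "\<dots> = pochhammer (2 * l) n * (- (pochhammer (\<alpha> + 2 * l) n * pochhammer l n * (- X)) /
        (pochhammer (2 * l) n * pochhammer (1 + l + \<alpha>) n * (\<alpha> + 2 * l)) *
      (pochhammer (- of_nat n) j * pochhammer \<alpha> j * pochhammer (- X + 1) j /
        (pochhammer (1 - l - of_nat n) j * pochhammer (\<alpha> + 2 * l + 1) j * pochhammer (- X) j) * B j))"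
      unfolding lj lin using Xj X0 d6 by (simp add: mult_ac)
    finally show "fact n * (pochhammer \<alpha> j * pochhammer l (n - j) * pochhammer (\<alpha> + 2 * l) n * (X - of_nat j) /
        (fact (n - j) * pochhammer (1 + l + \<alpha>) n * ((\<alpha> + 2 * l) * pochhammer (\<alpha> + 2 * l + 1) j)) * B j) =
      pochhammer (2 * l) n * (?G *
      (pochhammer (- of_nat n) j * pochhammer \<alpha> j * pochhammer (- \<alpha> - 2 * l - 2 * of_nat n + 1) j /
        (pochhammer (1 - l - of_nat n) j * pochhammer (\<alpha> + 2 * l + 1) j *
         pochhammer (- \<alpha> - 2 * l - 2 * of_nat n) j) * B j))"
      unfolding mX .
  qed
  finally show ?thesis by (simp only: mult_left_cancel[OF d6])
qed

section \<open>Zeros of \<open>Qhat\<close> and the theorem\<close>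

lemma pochs_0: "pochs as 0 = 1"
  by (induction as) (simp_all add: pochs_def)

lemma pochs_Cons: "pochs (a # as) k = pochhammer a k * pochs as k"
  by (simp add: pochs_def)

text \<open>As \<open>(z+1)_k / (z)_k = (z+k)/z\<close>, the product over the zeros is
  \<open>Q(-k) / Q(0)\<close>; the leading coefficient cancels. Multiplying by \<open>Q(0)\<close>
  avoids that division.\<close>

lemma pochs_zeros_quotient:
  fixes Q :: "complex poly"
  assumes zeros: "mset \<zeta> = proots Q" and nz: "\<forall>z\<in>set \<zeta>. z \<notin> \<int>\<^sub>\<le>\<^sub>0"
  shows "poly Q 0 * (pochs (map (\<lambda>z. z + 1) \<zeta>) k / pochs \<zeta> k) = poly Q (- of_nat k)"
proof -
  have Q: "poly Q x = lead_coeff Q * (\<Prod>z\<leftarrow>\<zeta>. x - z)" for x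
  proof -
    have "Q = smult (lead_coeff Q) (\<Prod>z\<in>#mset \<zeta>. [:-z, 1:])"
      unfolding zeros by (rule complex_poly_decompose_multiset[symmetric])
    moreover have "poly (\<Prod>z\<in>#mset \<zeta>. [:-z, 1:]) x = (\<Prod>z\<leftarrow>\<zeta>. x - z)"
      by (induction \<zeta>) (auto simp: algebra_simps)
    ultimately show ?thesis by (metis poly_smult)
  qed
  have "(\<Prod>z\<leftarrow>\<zeta>. 0 - z) * (pochs (map (\<lambda>z. z + 1) \<zeta>) k / pochs \<zeta> k) = (\<Prod>z\<leftarrow>\<zeta>. - of_nat k - z)"
    using nz
  proof (induction \<zeta>)
    case Nil
    show ?case by (simp add: pochs_def)
  next
    case (Cons z zs)
    have "pochhammer z k \<noteq> 0" using Cons.prems pochhammer_eq_0_imp_nonpos_Int by auto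
    moreover have "z * pochhammer (z + 1) k = pochhammer z k * (z + of_nat k)"
      using pochhammer_rec[of z k] pochhammer_Suc[of z k] by simp
    ultimately have factor: "(0 - z) * (pochhammer (z + 1) k / pochhammer z k) = - of_nat k - z"
      by (simp add: field_simps)
    have "((0 - z) * (pochhammer (z + 1) k / pochhammer z k)) *
        ((\<Prod>z\<leftarrow>zs. 0 - z) * (pochs (map (\<lambda>z. z + 1) zs) k / pochs zs k)) =
        (- of_nat k - z) * (\<Prod>z\<leftarrow>zs. - of_nat k - z)"
      unfolding factor using Cons by simp
    thus ?case by (simp add: pochs_def mult_ac)
  qed
  thus ?thesis unfolding Q by (simp only: mult.assoc)
qed

text \<open>\<open>Q\<close> stands for the polynomial from \<open>Qhat_is_polynomial\<close>, which
  its values determine; \<open>lower_lhs\<close>, \<open>lower_rhs\<close> and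
  \<open>denominators\<close> spell out the standing convention.\<close>

theorem mainTheorem8:
  fixes r n m :: nat and ms :: "nat list" and f \<zeta> :: "complex list"
    and a b c \<alpha> lam G :: complex and Q :: "complex poly"
  assumes "length f = r" and "length ms = r" and "m = sum_list ms"
    and lambda: "lam = c - a - b - of_nat m"
    and "pochhammer (1 + a + b - c) m \<noteq> 0"
    and "pochhammer (c - a - of_nat m) m \<noteq> 0"
    and "pochhammer (c - b - of_nat m) m \<noteq> 0"
    and Qhat: "\<And>t. poly Q t = Qhat a b c f ms t"
    and "degree Q = m"
    and zeros: "mset \<zeta> = proots Q"
    and lower_lhs: "\<forall>x \<in> set ([c, 1 + lam + \<alpha>, 1 - 2 * lam - of_nat n] @ f). x \<notin> \<int>\<^sub>\<le>\<^sub>0"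
    and lower_rhs: "\<forall>x \<in> set ([c, 1 - lam - of_nat n, \<alpha> + 2 * lam + 1,
                       - \<alpha> - 2 * lam - 2 * of_nat n] @ \<zeta>). x \<notin> \<int>\<^sub>\<le>\<^sub>0"
    and denominators: "pochhammer (2 * lam) n \<noteq> 0" "pochhammer (1 + lam + \<alpha>) n \<noteq> 0" "\<alpha> + 2 * lam \<noteq> 0"
    and G: "G = - (pochhammer (\<alpha> + 2 * lam) n * pochhammer lam n * (- \<alpha> - 2 * lam - 2 * of_nat n)) /
                 (pochhammer (2 * lam) n * pochhammer (1 + lam + \<alpha>) n * (\<alpha> + 2 * lam))"
  shows "hypF ([- of_nat n, a, b, \<alpha>] @ shift_list f ms)
              ([c, 1 + lam + \<alpha>, 1 - 2 * lam - of_nat n] @ f) =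
         G * hypF ([- of_nat n, a + lam, b + lam, \<alpha>, - \<alpha> - 2 * lam - 2 * of_nat n + 1] @ map (\<lambda>z. z + 1) \<zeta>)
                  ([c, 1 - lam - of_nat n, \<alpha> + 2 * lam + 1, - \<alpha> - 2 * lam - 2 * of_nat n] @ \<zeta>)"
proof -
  have nz: "pochhammer x k \<noteq> 0" if "x \<notin> \<int>\<^sub>\<le>\<^sub>0" for x :: complex and k
    using that pochhammer_eq_0_imp_nonpos_Int by blast
  define P where "P k = pochhammer a k * pochhammer b k / (pochhammer c k * fact k) *
      (pochs (shift_list f ms) k / pochs f k)" for k
  define B where "B k = pochhammer (a + lam) k * pochhammer (b + lam) k / (pochhammer c k * fact k) *
      poly Q (- of_nat k)" for k
  have conv: "B i = (\<Sum>s\<le>i. pochhammer lam (i - s) / fact (i - s) * P s)" for i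
    unfolding B_def P_def Qhat
    by (rule miller_paris_coefficients) (use assms nz in auto)
  \<comment> \<open>At index \<open>0\<close> the convolution reduces to \<open>B 0 = P 0\<close>,
    and \<open>P 0\<close> is \<open>1\<close>.\<close>
  have "poly Q 0 = 1"
    using conv[of 0] by (simp add: B_def P_def pochs_0)
  hence zk: "pochs (map (\<lambda>z. z + 1) \<zeta>) k / pochs \<zeta> k = poly Q (- of_nat k)" for k
    using pochs_zeros_quotient[OF zeros, of k] lower_rhs by simp
  have L: "hypF ([- of_nat n, a, b, \<alpha>] @ shift_list f ms) ([c, 1 + lam + \<alpha>, 1 - 2 * lam - of_nat n] @ f) =
      (\<Sum>k\<le>n. pochhammer (- of_nat n) k * pochhammer \<alpha> k /
        (pochhammer (1 + lam + \<alpha>) k * pochhammer (1 - 2 * lam - of_nat n) k) * P k)"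
    by (subst hypF_terminating[of n])
       (simp_all add: pochs_Cons P_def mult_ac)
  have R: "hypF ([- of_nat n, a + lam, b + lam, \<alpha>, - \<alpha> - 2 * lam - 2 * of_nat n + 1] @ map (\<lambda>z. z + 1) \<zeta>)
        ([c, 1 - lam - of_nat n, \<alpha> + 2 * lam + 1, - \<alpha> - 2 * lam - 2 * of_nat n] @ \<zeta>) =
      (\<Sum>j\<le>n. pochhammer (- of_nat n) j * pochhammer \<alpha> j * pochhammer (- \<alpha> - 2 * lam - 2 * of_nat n + 1) j /
        (pochhammer (1 - lam - of_nat n) j * pochhammer (\<alpha> + 2 * lam + 1) j *
         pochhammer (- \<alpha> - 2 * lam - 2 * of_nat n) j) * B j)"
    unfolding B_def zk[symmetric]
    by (subst hypF_terminating[of n])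
       (simp_all add: pochs_Cons mult_ac)
  show ?thesis
    unfolding L R G
    by (rule two_balanced_transformation[OF conv]) (use nz lower_lhs lower_rhs denominators in auto)
qed

end
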